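(* Let $a,b,\alpha,\beta$ be integers, let $(d_n)_{n\ge 0}$ be defined by $d_0=\alpha$, $d_1=\beta$ and $d_n=ad_{n-1}+bd_{n-2}$ for $n\ge 2$, and let $d_{-1}$ be an integer with $d_1=ad_0+bd_{-1}$. Let $(G,\ast)$ be a group, let $g_0,g_1\in G$, and let $(\varphi_n)_{n\ge 0}$ be the sequence in $G$ defined by $$\varphi_0=g_1^{\alpha}\ast g_0^{d_{-1}},\qquad \varphi_1=g_1^{\beta}\ast g_0^{\alpha},\qquad \varphi_n=\varphi_{n-1}^{a}\ast\varphi_{n-2}^{b}\quad (n\ge 2).$$ If $g_1\ast g_0=g_0\ast g_1$, then for all $n\in\mathbb{N}$, $$\varphi_n=g_1^{d_n}\ast g_0^{d_{n-1}}.$$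
   Context: For $g\in G$ and an integer $k$, $g^k$ denotes the usual $k$-th power of $g$ in the group $(G,\ast)$. Here $\mathbb{N}$ includes $0$. The sequence $(\varphi_n)$ is called the left d-type sequence attached to $\ast$, generated by $g_0$ and $g_1$. *)

theory Defs
  imports "HOL-Algebra.Group"
begin

end

theory Submission
  imports Defs
begin

text \<open>
  For commuting elements \<open>x\<close> and \<open>y\<close> of a group, \<open>(p, q) \<mapsto> x\<^sup>p \<otimes> y\<^sup>q\<close> is a homomorphism from
  the additive group of pairs of integers, because all powers of \<open>x\<close> commute with all powers
  of \<open>y\<close>. It therefore turns integer linear combinations of pairs into products of powers
  (\<open>int_pow_linear_combination\<close>). The pairs \<open>(d\<^sub>n, d\<^sub>n\<^sub>-\<^sub>1)\<close> satisfy the linear recurrence with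
  coefficients \<open>a\<close> and \<open>b\<close> from \<open>n = 2\<close> on: in the second component at \<open>n = 2\<close> this is exactly the
  condition that defines \<open>d\<^sub>-\<^sub>1\<close>. Their images satisfy the recurrence of
  \<open>\<phi>\<close> with the same initial values, and so coincide with \<open>\<phi>\<close>.
\<close>

context group
begin

lemma int_pow_commutes:
  fixes i :: int
  assumes comm: "x \<otimes> y = y \<otimes> x" and x: "x \<in> carrier G" and y: "y \<in> carrier G"
  shows "x [^] i \<otimes> y = y \<otimes> x [^] i"
proof (cases i rule: int_cases2)
  case (nonneg n)
  then show ?thesis
    using group_commutes_pow[OF comm x y] by (simp add: int_pow_int)
next
  case (nonpos n)
  have "x [^] n \<otimes> y = y \<otimes> x [^] n"
    using group_commutes_pow[OF comm x y] .
  \<comment> \<open>multiplying on both sides by the inverse of \<open>x\<^sup>n\<close>\<close>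
  then have "inv (x [^] n) \<otimes> y = y \<otimes> inv (x [^] n)"
    using x y by (metis inv_closed inv_solve_left inv_solve_right m_assoc m_closed nat_pow_closed)
  then show ?thesis
    using nonpos x by (simp add: int_pow_neg_int)
qed

lemma int_pow_int_pow_commute:
  fixes i j :: int
  assumes "x \<otimes> y = y \<otimes> x" and "x \<in> carrier G" and "y \<in> carrier G"
  shows "x [^] i \<otimes> y [^] j = y [^] j \<otimes> x [^] i"
  using assms int_pow_commutes[of y "x [^] i" j] int_pow_commutes[of x y i] by simp

lemma int_pow_linear_combination:
  fixes a b p q r s :: int
  assumes comm: "x \<otimes> y = y \<otimes> x" and x: "x \<in> carrier G" and y: "y \<in> carrier G"
  shows "(x [^] p \<otimes> y [^] q) [^] a \<otimes> (x [^] r \<otimes> y [^] s) [^] b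
       = x [^] (a * p + b * r) \<otimes> y [^] (a * q + b * s)"
proof -
  have pow: "(x [^] i \<otimes> y [^] j) [^] k = x [^] (k * i) \<otimes> y [^] (k * j)" for i j k :: int
    using x y int_pow_int_pow_commute[OF comm x y]
    by (simp add: int_pow_mult_distrib int_pow_pow mult.commute)
  have "(x [^] p \<otimes> y [^] q) [^] a \<otimes> (x [^] r \<otimes> y [^] s) [^] b
      = x [^] (a * p) \<otimes> (y [^] (a * q) \<otimes> x [^] (b * r)) \<otimes> y [^] (b * s)"
    using x y by (simp add: pow m_assoc)
  also have "\<dots> = x [^] (a * p) \<otimes> (x [^] (b * r) \<otimes> y [^] (a * q)) \<otimes> y [^] (b * s)"
    by (simp only: int_pow_int_pow_commute[OF comm x y])
  also have "\<dots> = x [^] (a * p + b * r) \<otimes> y [^] (a * q + b * s)"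
    using x y by (simp add: int_pow_mult m_assoc)
  finally show ?thesis .
qed

end

theorem proposition3p8:
  fixes G (structure)
    and a b \<alpha> \<beta> :: int
    and d :: "int \<Rightarrow> int"
    and g\<^sub>0 g\<^sub>1 :: 'a
    and \<phi> :: "nat \<Rightarrow> 'a"
  assumes "group G"
    and "g\<^sub>0 \<in> carrier G" and "g\<^sub>1 \<in> carrier G"
    and "d 0 = \<alpha>" and "d 1 = \<beta>"
    and "\<forall>n\<ge>2. d n = a * d (n - 1) + b * d (n - 2)"
    and "d 1 = a * d 0 + b * d (- 1)"
    and "\<phi> 0 = g\<^sub>1 [^] \<alpha> \<otimes> g\<^sub>0 [^] d (- 1)"
    and "\<phi> 1 = g\<^sub>1 [^] \<beta> \<otimes> g\<^sub>0 [^] \<alpha>"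
    and "\<forall>n\<ge>2. \<phi> n = \<phi> (n - 1) [^] a \<otimes> \<phi> (n - 2) [^] b"
    and "g\<^sub>1 \<otimes> g\<^sub>0 = g\<^sub>0 \<otimes> g\<^sub>1"
  shows "\<forall>n. \<phi> n = g\<^sub>1 [^] d (int n) \<otimes> g\<^sub>0 [^] d (int n - 1)"
proof -
  interpret group G by fact
  have rec: "d (int n + 1) = a * d (int n) + b * d (int n - 1)" for n
  proof (cases n)
    case 0
    then show ?thesis
      using assms(7) by simp
  next
    case (Suc m)
    then show ?thesis
      using assms(6)[rule_format, of "int n + 1"] by simp
  qed
  have "\<phi> n = g\<^sub>1 [^] d (int n) \<otimes> g\<^sub>0 [^] d (int n - 1)" for n
  proof (induction n rule: induct_nat_012)
    case 0
    then show ?case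
      using assms(4,8) by simp
  next
    case 1
    then show ?case
      using assms(4,5,9) by simp
  next
    case (ge2 n)
    have "\<phi> (Suc (Suc n)) = \<phi> (Suc n) [^] a \<otimes> \<phi> n [^] b"
      using assms(10)[rule_format, of "Suc (Suc n)"] by simp
    also have "\<dots> = g\<^sub>1 [^] (a * d (int (Suc n)) + b * d (int n))
                   \<otimes> g\<^sub>0 [^] (a * d (int (Suc n) - 1) + b * d (int n - 1))"
      unfolding ge2 by (rule int_pow_linear_combination) fact+
    also have "\<dots> = g\<^sub>1 [^] d (int (Suc (Suc n))) \<otimes> g\<^sub>0 [^] d (int (Suc (Suc n)) - 1)"
      using rec[of n] rec[of "Suc n"] by (simp add: add.commute)
    finally show ?case .
  qed
  then show ?thesis
    by blast
qed

end
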